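(* Let $f$ satisfy Assumption B (see context) with constants $1<L^+\le L^-$, and let $$\underline\beta_0:=\frac{L^-L^+-1}{(L^-+1)(L^++1)}.$$ Then for every $\alpha\in(\underline\beta_0,1)$ and every $x_0>0$ the solution of $$x_{n+1}=(1-\alpha)f(x_n)+\alpha x_n,\qquad n=0,1,2,\dots,$$ satisfies $\lim_{n\to\infty}x_n=K$.
   Context: Assumption A on $f$: $f:[0,\infty)\to[0,\infty)$ is continuous, $f(0)=0$, $f$ has exactly one positive equilibrium (fixed point) $K>0$, which is locally unstable (not Lyapunov stable) for $x_{n+1}=f(x_n)$; $f(x)>x$ for $x\in(0,K)$ and $0<f(x)<x$ for $x\in(K,\infty)$. Notation: $f_m:=\max_{x\in[0,K]}f(x)$; $x_{\max}$ is the largest point of $[0,K]$ at which this maximum is attained. One has $K<f_m$. Assumption B on $f$: Assumption A holds and for some constants $L^-\ge L^+>1$, $f(x)-K\le L^-(K-x)$ for $x\in(x_{\max},K)$ and $K-f(x)\le L^+(x-K)$ for $x\in(K,f_m)$. *)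

theory Defs
  imports "HOL-Analysis.Analysis"
begin

text \<open>
  A map of \<open>[0,\<infinity>)\<close> into itself is a function on \<^typ>\<open>real\<close> of which only the
  restriction to \<open>{0..}\<close> matters. In particular, continuity and stability are relative to \<open>{0..}\<close>.
\<close>

definition lyapunov_stable_on :: "real set \<Rightarrow> (real \<Rightarrow> real) \<Rightarrow> real \<Rightarrow> bool" where
  "lyapunov_stable_on S f p \<longleftrightarrow>
     (\<forall>\<epsilon>>0. \<exists>\<delta>>0. \<forall>y\<in>S. \<bar>y - p\<bar> < \<delta> \<longrightarrow> (\<forall>n. \<bar>(f ^^ n) y - p\<bar> < \<epsilon>))"

definition assumption_A :: "(real \<Rightarrow> real) \<Rightarrow> real \<Rightarrow> bool" where
  "assumption_A f K \<longleftrightarrow>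
     f ` {0..} \<subseteq> {0..} \<and> continuous_on {0..} f \<and> f 0 = 0 \<and>
     K > 0 \<and> f K = K \<and> (\<forall>y>0. f y = y \<longrightarrow> y = K) \<and>
     \<not> lyapunov_stable_on {0..} f K \<and>
     (\<forall>y\<in>{0<..<K}. f y > y) \<and>
     (\<forall>y\<in>{K<..}. 0 < f y \<and> f y < y)"

text \<open>
  The following two greatest elements exist whenever \<open>f\<close> is continuous on \<open>{0..K}\<close> and \<open>0 \<le> K\<close>
  (see \<open>f_max_attained\<close>, \<open>f_max_upper\<close>, \<open>x_max_attained\<close> and \<open>x_max_upper\<close> below).
\<close>

definition f_max :: "(real \<Rightarrow> real) \<Rightarrow> real \<Rightarrow> real" where
  "f_max f K = (GREATEST v. v \<in> f ` {0..K})"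

definition x_max :: "(real \<Rightarrow> real) \<Rightarrow> real \<Rightarrow> real" where
  "x_max f K = (GREATEST y. y \<in> {0..K} \<and> f y = f_max f K)"

definition assumption_B :: "(real \<Rightarrow> real) \<Rightarrow> real \<Rightarrow> real \<Rightarrow> real \<Rightarrow> bool" where
  "assumption_B f K Lm Lp \<longleftrightarrow>
     assumption_A f K \<and> 1 < Lp \<and> Lp \<le> Lm \<and>
     (\<forall>y\<in>{x_max f K<..<K}. f y - K \<le> Lm * (K - y)) \<and>
     (\<forall>y\<in>{K<..<f_max f K}. K - f y \<le> Lp * (y - K))"

definition beta0_lower :: "real \<Rightarrow> real \<Rightarrow> real" where
  "beta0_lower Lm Lp = (Lm * Lp - 1) / ((Lm + 1) * (Lp + 1))"

lemma Greatest_compact: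
  fixes S :: "real set"
  assumes "compact S" "S \<noteq> {}"
  shows "(GREATEST v. v \<in> S) \<in> S" and "\<And>y. y \<in> S \<Longrightarrow> y \<le> (GREATEST v. v \<in> S)"
proof -
  obtain m where m: "m \<in> S" "\<And>y. y \<in> S \<Longrightarrow> y \<le> m"
    using compact_attains_sup[OF assms] by blast
  then have "(GREATEST v. v \<in> S) = m" by (intro Greatest_equality) auto
  with m show "(GREATEST v. v \<in> S) \<in> S" "\<And>y. y \<in> S \<Longrightarrow> y \<le> (GREATEST v. v \<in> S)" by auto
qed

context
  fixes f :: "real \<Rightarrow> real" and K :: real
  assumes cont: "continuous_on {0..K} f" and K: "0 \<le> K"
begin

lemma f_max_attained: "f_max f K \<in> f ` {0..K}"
  and f_max_upper: "y \<in> {0..K} \<Longrightarrow> f y \<le> f_max f K"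
proof -
  have "compact (f ` {0..K})" "f ` {0..K} \<noteq> {}"
    using cont K by (auto intro: compact_continuous_image)
  from Greatest_compact[OF this] show "f_max f K \<in> f ` {0..K}"
    "y \<in> {0..K} \<Longrightarrow> f y \<le> f_max f K"
    unfolding f_max_def by blast+
qed

lemma x_max_attained: "x_max f K \<in> {0..K} \<and> f (x_max f K) = f_max f K"
  and x_max_upper: "y \<in> {0..K} \<Longrightarrow> f y = f_max f K \<Longrightarrow> y \<le> x_max f K"
proof -
  let ?S = "{y \<in> {0..K}. f y = f_max f K}"
  have "closed ?S"
    using continuous_closed_preimage_constant[OF cont] by simp
  then have "compact ({0..K} \<inter> ?S)" by (intro compact_Int_closed) auto
  moreover have "{0..K} \<inter> ?S = ?S" by auto
  ultimately have "compact ?S" by simp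
  moreover have "?S \<noteq> {}" using f_max_attained by force
  ultimately show "x_max f K \<in> {0..K} \<and> f (x_max f K) = f_max f K"
    "y \<in> {0..K} \<Longrightarrow> f y = f_max f K \<Longrightarrow> y \<le> x_max f K"
    using Greatest_compact[of ?S] unfolding x_max_def by auto
qed

end

end

theory Submission
  imports Defs
begin

text \<open>
  Write \<open>g y = (1 - \<alpha>) * f y + \<alpha> * y\<close> for the controlled map. Averaging with the identity keeps
  the sign of \<open>f y - y\<close>, so an orbit moves towards \<open>K\<close> as long as it does not jump over \<open>K\<close>.
  A jump is controlled by the slope bounds: with \<open>A = (1 - \<alpha>) * Lm - \<alpha>\<close> and
  \<open>B = (1 - \<alpha>) * Lp - \<alpha>\<close>, a jump from the left multiplies the distance to \<open>K\<close> by at most \<open>A\<close>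
  and a jump from the right by at most \<open>B\<close>. The threshold \<open>beta0_lower Lm Lp\<close> is the only
  \<open>\<alpha> < 1\<close> with \<open>A * B = 1\<close>, and \<open>A * B < 1\<close> between it and 1
  (\<open>controlled_slopes_product\<close>).

  Since \<open>A\<close> itself may exceed 1, the plain distance to \<open>K\<close> need not decrease.
  Choose \<open>c > 0\<close> with \<open>c * A < 1\<close> and \<open>B < c\<close> and
  measure distances on the right of \<open>K\<close> in units of \<open>1 / c\<close>: the weighted distance
  \<open>max (K - y) (c * (y - K))\<close> strictly decreases along \<open>g\<close> away from \<open>K\<close>
  (\<open>weighted_dist_decreases\<close>). LaSalle's principle on a compact interval
  (\<open>lasalle_limit\<close>) then forces the weighted distance to tend to 0.

  The compact interval exists because an orbit that has visited the left of \<open>K\<close> never again exceeds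
  \<open>(1 - \<alpha>) * f_max f K + \<alpha> * K\<close>, and because the weighted distance at a point of \<open>{0<..K}\<close>
  is less than \<open>K\<close>, which keeps all later points away from 0. An orbit that never visits the
  left of \<open>K\<close> is decreasing, and the same principle applies to it with the identity as
  Lyapunov function.
\<close>

text \<open>
  LaSalle's principle for a scalar recursion: the Lyapunov function is constant on limit points
  of the orbit, and the limit points are mapped to limit points.
\<close>

lemma lasalle_limit:
  fixes z :: "nat \<Rightarrow> 'a::metric_space" and V :: "'a \<Rightarrow> real"
  assumes "compact C" and z_in: "\<And>n. z n \<in> C" and z_Suc: "\<And>n. z (Suc n) = g (z n)"
    and g: "continuous_on C g" and V: "continuous_on C V"
    and dec: "\<And>n. V (z (Suc n)) \<le> V (z n)"
  obtains p where "p \<in> C" "V (g p) = V p" "(\<lambda>n. V (z n)) \<longlonglongrightarrow> V p"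
proof -
  obtain p r where p: "p \<in> C" and r: "strict_mono r" and lim: "(z \<circ> r) \<longlonglongrightarrow> p"
    using \<open>compact C\<close> z_in unfolding compact_def by blast
  have "bounded (V ` C)"
    using \<open>compact C\<close> V by (intro compact_imp_bounded compact_continuous_image)
  then obtain b where b: "\<And>y. y \<in> C \<Longrightarrow> \<bar>V y\<bar> \<le> b"
    unfolding bounded_iff by auto
  have "decseq (\<lambda>n. V (z n))" using dec by (rule decseq_SucI)
  moreover have "\<forall>n. - b \<le> V (z n)"
    using b[OF z_in] by (metis abs_le_D2 minus_le_iff)
  ultimately obtain v where v: "(\<lambda>n. V (z n)) \<longlonglongrightarrow> v"
    using decseq_convergent by metis
  have subseq: "(\<lambda>n. V (z (r n))) \<longlonglongrightarrow> v"
    using LIMSEQ_subseq_LIMSEQ[OF v r] by (simp add: o_def)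
  have "(\<lambda>n. V (z (r n))) \<longlonglongrightarrow> V p"
    using continuous_on_tendsto_compose[OF V, of "z \<circ> r"] lim p z_in by (simp add: o_def)
  with subseq have Vp: "V p = v" using LIMSEQ_unique by blast
  have lim_g: "(\<lambda>n. z (Suc (r n))) \<longlonglongrightarrow> g p"
    using continuous_on_tendsto_compose[OF g, of "z \<circ> r"] lim p z_in
    by (simp add: o_def z_Suc)
  have "g p \<in> C"
    using closed_sequentially[OF compact_imp_closed[OF \<open>compact C\<close>] _ lim_g] z_in by blast
  then have "(\<lambda>n. V (z (Suc (r n)))) \<longlonglongrightarrow> V (g p)"
    using continuous_on_tendsto_compose[OF V lim_g] z_in by simp
  moreover have "(\<lambda>n. V (z (Suc (r n)))) \<longlonglongrightarrow> v"
    using LIMSEQ_subseq_LIMSEQ[OF LIMSEQ_Suc[OF v] r] by (simp add: o_def)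
  ultimately have "V (g p) = v" using LIMSEQ_unique by blast
  with that p Vp v show thesis by auto
qed

text \<open>
  The product is \<open>1 + s * (s * p * q - (p + q))\<close> for \<open>s = 1 - \<alpha>\<close>, \<open>p = Lm + 1\<close>, \<open>q = Lp + 1\<close>,
  and \<open>\<alpha> > beta0_lower Lm Lp\<close> says that \<open>s < 1 / p + 1 / q\<close>.
\<close>

lemma controlled_slopes_product:
  fixes Lm Lp \<alpha> :: real
  assumes "0 \<le> Lm" "0 \<le> Lp" "beta0_lower Lm Lp < \<alpha>" "\<alpha> < 1"
  shows "((1 - \<alpha>) * Lm - \<alpha>) * ((1 - \<alpha>) * Lp - \<alpha>) < 1"
proof -
  have "Lm * Lp - 1 < \<alpha> * ((Lm + 1) * (Lp + 1))"
    using assms by (simp add: beta0_lower_def pos_divide_less_eq)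
  then have "(1 - \<alpha>) * ((1 - \<alpha>) * ((Lm + 1) * (Lp + 1)) - ((Lm + 1) + (Lp + 1))) < 0"
    using \<open>\<alpha> < 1\<close> by (intro mult_pos_neg) (simp_all add: algebra_simps)
  moreover have "((1 - \<alpha>) * Lm - \<alpha>) * ((1 - \<alpha>) * Lp - \<alpha>) =
      1 + (1 - \<alpha>) * ((1 - \<alpha>) * ((Lm + 1) * (Lp + 1)) - ((Lm + 1) + (Lp + 1)))"
    by (simp add: algebra_simps)
  ultimately show ?thesis by linarith
qed

lemma balancing_weight_exists:
  fixes A B :: real
  assumes "A * B < 1"
  obtains c where "c > 0" "c * A < 1" "B < c"
proof (cases "A > 0")
  case True
  then have "max B 0 < 1 / A" using assms by (simp add: pos_less_divide_eq mult.commute)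
  then obtain c where "max B 0 < c" "c < 1 / A" using dense by blast
  with True that[of c] show thesis by (simp add: pos_less_divide_eq)
next
  case False
  have "(max B 0 + 1) * A \<le> 0"
    using False by (intro mult_nonneg_nonpos) auto
  then show thesis by (intro that[of "max B 0 + 1"]) auto
qed

text \<open>
  Left of \<open>x_max f K\<close> the bound on \<open>f\<close> is inherited from \<open>x_max f K\<close> itself: there \<open>f\<close> is largest,
  while the right-hand side only grows to the left.
\<close>

lemma left_slope_bound:
  assumes B: "assumption_B f K Lm Lp" and y: "y \<in> {0..K}"
  shows "f y - K \<le> Lm * (K - y)"
proof -
  let ?m = "x_max f K"
  have K: "0 \<le> K" "f K = K" and Lm: "0 < Lm" and "continuous_on {0..} f"
    and open_bound: "\<And>w. w \<in> {?m<..<K} \<Longrightarrow> f w - K \<le> Lm * (K - w)"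
    using B by (auto simp: assumption_B_def assumption_A_def)
  then have cont: "continuous_on {0..K} f" by (auto intro: continuous_on_subset)
  have m: "?m \<in> {0..K}" "f ?m = f_max f K"
    using x_max_attained[OF cont \<open>0 \<le> K\<close>] by auto
  have closed_bound: "f w - K \<le> Lm * (K - w)" if w: "w \<in> {?m..K}" for w
  proof (cases "?m < K")
    case True
    have "f w - K - Lm * (K - w) \<le> 0"
    proof (rule continuous_le_on_closure[where f = "\<lambda>w. f w - K - Lm * (K - w)"])
      show "w \<in> closure {?m<..<K}" using w True by simp
      show "continuous_on (closure {?m<..<K}) (\<lambda>w. f w - K - Lm * (K - w))"
        using m True by (intro continuous_intros continuous_on_subset[OF cont]) auto
    qed (use open_bound in fastforce)
    then show ?thesis by simp
  next
    case False
    with w have "w = K" by auto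
    then show ?thesis using K by simp
  qed
  show ?thesis
  proof (cases "y \<le> ?m")
    case True
    have "f y - K \<le> f ?m - K"
      using f_max_upper[OF cont \<open>0 \<le> K\<close> y] m by simp
    also have "\<dots> \<le> Lm * (K - ?m)" using m by (intro closed_bound) auto
    also have "\<dots> \<le> Lm * (K - y)" using True Lm by simp
    finally show ?thesis .
  qed (use closed_bound y in auto)
qed

text \<open>
  A step that stays on one side of \<open>K\<close> moves towards \<open>K\<close>. A step from left to right is
  at most \<open>c * ((1 - \<alpha>) * Lm - \<alpha>) < 1\<close> times as far from \<open>K\<close> in the weighted distance, and a step
  from right to left at most \<open>((1 - \<alpha>) * Lp - \<alpha>) / c < 1\<close> times.
\<close>

lemma weighted_dist_decreases:
  fixes f :: "real \<Rightarrow> real" and K c \<alpha> :: real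
  defines "g \<equiv> \<lambda>y. (1 - \<alpha>) * f y + \<alpha> * y"
    and "V \<equiv> \<lambda>y. max (K - y) (c * (y - K))"
  assumes c: "c > 0" "c * ((1 - \<alpha>) * Lm - \<alpha>) < 1" "(1 - \<alpha>) * Lp - \<alpha> < c"
    and \<alpha>: "\<alpha> < 1" and "y \<noteq> K"
    and left: "y < K \<Longrightarrow> y < f y \<and> f y - K \<le> Lm * (K - y)"
    and right: "K < y \<Longrightarrow> f y < y \<and> K - f y \<le> Lp * (y - K)"
  shows "V (g y) < V y"
proof (cases "y < K")
  case True
  have "(1 - \<alpha>) * y < (1 - \<alpha>) * f y" using left True \<alpha> by simp
  then have "y < g y" by (simp add: g_def algebra_simps)
  have "(1 - \<alpha>) * (f y - K) \<le> (1 - \<alpha>) * (Lm * (K - y))"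
    using left True \<alpha> by (intro mult_left_mono) auto
  then have "g y - K \<le> ((1 - \<alpha>) * Lm - \<alpha>) * (K - y)"
    by (simp add: g_def algebra_simps)
  then have "c * (g y - K) \<le> c * (((1 - \<alpha>) * Lm - \<alpha>) * (K - y))"
    using c by (intro mult_left_mono) auto
  also have "\<dots> < 1 * (K - y)"
    using True c(2) by (simp flip: mult.assoc)
  finally show ?thesis using \<open>y < g y\<close> by (simp add: V_def less_max_iff_disj)
next
  case False
  with \<open>y \<noteq> K\<close> have "K < y" by simp
  have "(1 - \<alpha>) * f y < (1 - \<alpha>) * y" using right \<open>K < y\<close> \<alpha> by simp
  then have "g y < y" by (simp add: g_def algebra_simps)
  have "(1 - \<alpha>) * (K - f y) \<le> (1 - \<alpha>) * (Lp * (y - K))"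
    using right \<open>K < y\<close> \<alpha> by (intro mult_left_mono) auto
  then have "K - g y \<le> ((1 - \<alpha>) * Lp - \<alpha>) * (y - K)"
    by (simp add: g_def algebra_simps)
  also have "\<dots> < c * (y - K)" using \<open>K < y\<close> c(3) by simp
  finally show ?thesis using \<open>g y < y\<close> c(1) by (simp add: V_def less_max_iff_disj)
qed

theorem proposition1:
  fixes f :: "real \<Rightarrow> real" and K Lm Lp \<alpha> x\<^sub>0 :: real and x :: "nat \<Rightarrow> real"
  assumes "assumption_B f K Lm Lp"
    and "\<alpha> \<in> {beta0_lower Lm Lp<..<1}"
    and "x\<^sub>0 > 0"
    and "x 0 = x\<^sub>0"
    and "\<And>n. x (Suc n) = (1 - \<alpha>) * f (x n) + \<alpha> * x n"
  shows "x \<longlonglongrightarrow> K"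
proof -
  define g where "g = (\<lambda>y. (1 - \<alpha>) * f y + \<alpha> * y)"
  have x_Suc: "x (Suc n) = g (x n)" for n using assms(5) by (simp add: g_def)
  have K: "K > 0" "f K = K" and cont: "continuous_on {0..} f"
    and L: "1 < Lp" "1 < Lm"
    and above: "\<And>y. 0 < y \<Longrightarrow> y < K \<Longrightarrow> y < f y"
    and below: "\<And>y. K < y \<Longrightarrow> 0 < f y \<and> f y < y"
    and right_slope: "\<And>y. K < y \<Longrightarrow> y < f_max f K \<Longrightarrow> K - f y \<le> Lp * (y - K)"
    using assms(1) by (auto simp: assumption_B_def assumption_A_def)
  have contK: "continuous_on {0..K} f" using cont by (auto intro: continuous_on_subset)
  have "1 < Lm * Lp" using L by (simp add: less_1_mult)
  then have "0 < beta0_lower Lm Lp" using L by (simp add: beta0_lower_def)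
  with assms(2) have \<alpha>: "beta0_lower Lm Lp < \<alpha>" "0 < \<alpha>" "\<alpha> < 1" by auto
  have cont_g: "continuous_on C g" if "C \<subseteq> {0..}" for C
    unfolding g_def using that by (intro continuous_intros continuous_on_subset[OF cont])
  have f_pos: "0 < f y" if "0 < y" for y
    using that above[of y] below[of y] K by (cases y K rule: linorder_cases) auto
  have g_pos: "0 < g y" if "0 < y" for y
    unfolding g_def using that f_pos[OF that] \<alpha> by (intro add_pos_pos mult_pos_pos) auto
  have g_below: "g y < y" if "K < y" for y
  proof -
    have "(1 - \<alpha>) * f y < (1 - \<alpha>) * y" using below[OF that] \<alpha> by simp
    then show ?thesis by (simp add: g_def algebra_simps)
  qed
  have x_pos: "0 < x n" for n
    using assms(3,4) g_pos by (induction n) (auto simp: x_Suc)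
  show ?thesis
  proof (cases "\<exists>N. x N \<le> K")
    case False
    then have right: "K < x n" for n by (meson not_le)
    have dec: "x (Suc n) \<le> x n" for n using g_below[OF right] by (simp add: x_Suc less_imp_le)
    then have "x n \<le> x 0" for n using decseqD[OF decseq_SucI, of x 0 n] by blast
    then have "x n \<in> {K..x 0}" for n using right[of n] by simp
    then obtain p where p: "p \<in> {K..x 0}" "g p = p" "x \<longlonglongrightarrow> p"
      using lasalle_limit[of "{K..x 0}" x g "\<lambda>y. y"] x_Suc dec K cont_g by auto
    then have "p = K" using g_below[of p] by force
    with p show ?thesis by simp
  next
    case True
    then obtain N where N: "x N \<le> K" by blast
    obtain c where c: "c > 0" "c * ((1 - \<alpha>) * Lm - \<alpha>) < 1" "(1 - \<alpha>) * Lp - \<alpha> < c"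
      using balancing_weight_exists[OF controlled_slopes_product[of Lm Lp \<alpha>]] L \<alpha> by auto
    define V where "V = (\<lambda>y. max (K - y) (c * (y - K)))"
    define M where "M = (1 - \<alpha>) * f_max f K + \<alpha> * K"
    have fmax: "f y \<le> f_max f K" if "0 \<le> y" "y \<le> K" for y
      using f_max_upper[OF contK] that K by simp
    then have fmax_K: "K \<le> f_max f K" using K by (metis less_imp_le order_refl)
    have "(1 - \<alpha>) * K \<le> (1 - \<alpha>) * f_max f K" using fmax_K \<alpha> by simp
    then have KM: "K \<le> M" by (simp add: M_def algebra_simps)
    \<comment> \<open>Strictness matters: the slope bound on the right is only given below \<open>f_max f K\<close>,
      and limit points of the orbit in \<open>{..M}\<close> must satisfy it too.\<close>
    have M_less: "y < f_max f K" if "K < y" "y \<le> M" for y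
    proof -
      have "K < f_max f K"
        using that fmax_K by (cases "f_max f K = K") (auto simp: M_def algebra_simps)
      then have "\<alpha> * K < \<alpha> * f_max f K" using \<alpha> by simp
      then have "M < f_max f K" by (simp add: M_def algebra_simps)
      with that show ?thesis by simp
    qed
    have V_less: "V (g y) < V y" if "0 < y" "y \<le> M" "y \<noteq> K" for y
      unfolding V_def g_def
    proof (rule weighted_dist_decreases[OF c \<open>\<alpha> < 1\<close> \<open>y \<noteq> K\<close>])
      assume "y < K"
      then show "y < f y \<and> f y - K \<le> Lm * (K - y)"
        using above left_slope_bound[OF assms(1)] that by simp
    next
      assume "K < y"
      then show "f y < y \<and> K - f y \<le> Lp * (y - K)"
        using below right_slope M_less that by simp
    qed
    have g_K: "g K = K" using K by (simp add: g_def algebra_simps)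
    have V_le: "V (g y) \<le> V y" if "0 < y" "y \<le> M" for y
      using V_less[OF that] g_K by (cases "y = K") auto
    have g_le_M: "g y \<le> M" if "0 < y" "y \<le> M" for y
    proof (cases "y \<le> K")
      case True
      then show ?thesis
        unfolding g_def M_def using fmax that \<alpha> by (intro add_mono mult_left_mono) auto
    next
      case False
      then show ?thesis using g_below[of y] that by simp
    qed
    define z where "z = (\<lambda>n. x (n + N))"
    have z_Suc: "z (Suc n) = g (z n)" for n by (simp add: z_def x_Suc)
    have z_pos: "0 < z n" for n by (simp add: z_def x_pos)
    have z_le: "z n \<le> M" for n
      using N KM by (induction n) (auto simp: z_Suc g_le_M z_pos, simp add: z_def)
    have dec: "V (z (Suc n)) \<le> V (z n)" for n
      using V_le z_pos z_le by (simp add: z_Suc)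
    then have "V (z n) \<le> V (z 0)" for n
      using decseqD[OF decseq_SucI, of "\<lambda>n. V (z n)" 0 n] by blast
    moreover have "V (z 0) = K - x N"
      using N c(1) mult_nonneg_nonpos[of c "x N - K"] by (simp add: V_def z_def)
    moreover have "K - y \<le> V y" for y by (simp add: V_def)
    ultimately have "K - z n \<le> K - x N" for n by (metis order_trans)
    then have z_in: "z n \<in> {x N..M}" for n using z_le by simp
    have "continuous_on {x N..M} V" unfolding V_def by (intro continuous_intros)
    then obtain p where p: "p \<in> {x N..M}" "V (g p) = V p" "(\<lambda>n. V (z n)) \<longlonglongrightarrow> V p"
      using lasalle_limit[of "{x N..M}" z g V] z_in z_Suc dec x_pos[of N] cont_g by auto
    then have "p = K" using V_less[of p] x_pos[of N] by force
    then have lim: "(\<lambda>n. V (z n)) \<longlonglongrightarrow> 0" using p by (simp add: V_def)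
    have "z \<longlonglongrightarrow> K"
    proof (rule tendsto_sandwich)
      have "K - V (z n) \<le> z n" for n by (simp add: V_def max_def)
      then show "\<forall>\<^sub>F n in sequentially. K - V (z n) \<le> z n" by simp
      have "c * (z n - K) \<le> V (z n)" for n by (simp add: V_def)
      then have "z n \<le> K + V (z n) / c" for n
        using c(1) by (simp add: field_simps)
      then show "\<forall>\<^sub>F n in sequentially. z n \<le> K + V (z n) / c" by simp
      show "(\<lambda>n. K - V (z n)) \<longlonglongrightarrow> K"
        using tendsto_diff[OF tendsto_const lim, of K] by simp
      show "(\<lambda>n. K + V (z n) / c) \<longlonglongrightarrow> K"
        using tendsto_add[OF tendsto_const tendsto_divide[OF lim tendsto_const[of c]], of K] c(1)
        by simp
    qed
    then show ?thesis unfolding z_def by (rule LIMSEQ_offset)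
  qed
qed

end
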